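(* Let $T>0$, $K>0$. For every fixed $x\in C([-1,T])$, the map $$\mathfrak m_T\ni\mu\mapsto\mathfrak G_\mu(x)\in AC([0,T]),\qquad \mathfrak G_\mu(x)[t]=x(0)+\int_0^t\int_{[-1,0]}x(\tau+s)\,d\mu_\tau(s)\,d\tau,$$ is sequentially continuous (with respect to almost-everywhere weak-* convergence of coefficient paths). However, this map need not be continuous for the relative product topology on $\mathfrak m_T$: for $x\equiv1$, it is discontinuous at the zero parameter $\mu\equiv0$.
   Context: Let $\mathfrak m$ be the set of finite signed Borel measures $\nu$ on $[-1,0]$ with $\|\nu\|_{\mathrm{TV}}\le K$, with the relative weak-* topology (duality with $C([-1,0])$). $\mathfrak m_T\subset\mathfrak m^{[0,T]}$ is the set of all maps $\mu:[0,T]\to\mathfrak m$, $t\mapsto\mu_t$, such that for every $f\in C([-1,0])$ the function $t\mapsto\int_{[-1,0]}f\,d\mu_t$ is Lebesgue measurable on $[0,T]$. The relative product topology on $\mathfrak m_T$ is the subspace topology inherited from the product (Tychonoff) topology of $\mathfrak m^{[0,T]}$. Sequential convergence $\mu^{(n)}\to\mu$ in $\mathfrak m_T$ means: for Lebesgue-almost every $t\in[0,T]$, $\int f\,d\mu^{(n)}_t\to\int f\,d\mu_t$ for every $f\in C([-1,0])$ (convergence in the product topology implies this). $AC([0,T])$ is the space of real absolutely continuous functions on $[0,T]$ with norm $\|u\|_{AC}=|u(0)|+\int_0^T|u'(t)|\,dt$. *)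

theory Defs
  imports "HOL-Analysis.Analysis"
begin

section \<open>Finite signed measures\<close>

text \<open>
  A finite signed measure on the measurable space \<open>M\<close> (only \<open>space M\<close> and \<open>sets M\<close> matter) is a
  countably additive real-valued set function on \<open>sets M\<close>. It is required to vanish off \<open>sets M\<close>,
  so that equality of set functions is equality of signed measures.
\<close>

definition signed_measure :: "'a measure \<Rightarrow> ('a set \<Rightarrow> real) \<Rightarrow> bool" where
  "signed_measure M \<nu> \<longleftrightarrow>
     \<nu> {} = 0 \<and>
     (\<forall>A :: nat \<Rightarrow> 'a set. range A \<subseteq> sets M \<longrightarrow> disjoint_family A \<longrightarrow>
        (\<lambda>n. \<nu> (A n)) sums \<nu> (\<Union>n. A n)) \<and>
     (\<forall>A. A \<notin> sets M \<longrightarrow> \<nu> A = 0)"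

definition total_variation :: "'a measure \<Rightarrow> ('a set \<Rightarrow> real) \<Rightarrow> ennreal" where
  "total_variation M \<nu> =
     (SUP P \<in> {P. finite P \<and> P \<subseteq> sets M \<and> partition_on (space M) P}. \<Sum>A\<in>P. ennreal \<bar>\<nu> A\<bar>)"

text \<open>
  The positive part of the Jordan decomposition; the negative part is that of \<open>-\<nu>\<close>. Negative values
  are truncated by \<open>ennreal\<close>, which is harmless since \<open>B = {}\<close> already contributes \<open>0\<close>.
\<close>

definition positive_part :: "'a measure \<Rightarrow> ('a set \<Rightarrow> real) \<Rightarrow> 'a measure" where
  "positive_part M \<nu> =
     measure_of (space M) (sets M) (\<lambda>A. SUP B \<in> {B \<in> sets M. B \<subseteq> A}. ennreal (\<nu> B))"

definition signed_integral :: "'a measure \<Rightarrow> ('a set \<Rightarrow> real) \<Rightarrow> ('a \<Rightarrow> real) \<Rightarrow> real" where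
  "signed_integral M \<nu> f =
     (\<integral>s. f s \<partial>positive_part M \<nu>) - (\<integral>s. f s \<partial>positive_part M (\<lambda>A. - \<nu> A))"


section \<open>The parameter space\<close>

abbreviation delay_borel :: "real measure" where
  "delay_borel \<equiv> restrict_space borel {-1..0}"

text \<open>
  Elements of \<open>C([-1,0])\<close> are represented by functions on the reals that are continuous on
  \<open>{-1..0}\<close>; values elsewhere do not enter the integrals, whose measures live on \<open>{-1..0}\<close>.
\<close>

definition weak_star :: "(real set \<Rightarrow> real) topology" where
  "weak_star = topology_generated_by
     {{\<nu>. signed_measure delay_borel \<nu> \<and> signed_integral delay_borel \<nu> f \<in> U} | f U.
        continuous_on {-1..0} f \<and> open U}"

definition coeffs :: "real \<Rightarrow> (real set \<Rightarrow> real) set" where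
  "coeffs K = {\<nu>. signed_measure delay_borel \<nu> \<and> total_variation delay_borel \<nu> \<le> ennreal K}"

definition coeff_paths :: "real \<Rightarrow> real \<Rightarrow> (real \<Rightarrow> real set \<Rightarrow> real) set" where
  "coeff_paths K T = {\<mu> \<in> {0..T} \<rightarrow>\<^sub>E coeffs K. \<forall>f. continuous_on {-1..0} f \<longrightarrow>
     (\<lambda>t. signed_integral delay_borel (\<mu> t) f) \<in> borel_measurable (lebesgue_on {0..T})}"

definition coeff_paths_topology :: "real \<Rightarrow> real \<Rightarrow> (real \<Rightarrow> real set \<Rightarrow> real) topology" where
  "coeff_paths_topology K T =
     subtopology (product_topology (\<lambda>_. subtopology weak_star (coeffs K)) {0..T}) (coeff_paths K T)"

definition zero_path :: "real \<Rightarrow> real \<Rightarrow> real set \<Rightarrow> real" where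
  "zero_path T = (\<lambda>t\<in>{0..T}. \<lambda>A. 0)"

definition ae_weak_star_tendsto ::
    "real \<Rightarrow> (nat \<Rightarrow> real \<Rightarrow> real set \<Rightarrow> real) \<Rightarrow> (real \<Rightarrow> real set \<Rightarrow> real) \<Rightarrow> bool" where
  "ae_weak_star_tendsto T \<mu>s \<mu> \<longleftrightarrow>
     (AE t in lebesgue_on {0..T}. \<forall>f. continuous_on {-1..0} f \<longrightarrow>
        (\<lambda>n. signed_integral delay_borel (\<mu>s n t) f)
          \<longlonglongrightarrow> signed_integral delay_borel (\<mu> t) f)"


section \<open>Absolutely continuous functions\<close>

text \<open>
  Only the restriction of \<open>u\<close> to \<open>{0..T}\<close> matters; \<open>deriv u\<close> could depend on values outside
  only at the two endpoints.
\<close>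

definition ac_space :: "real \<Rightarrow> (real \<Rightarrow> real) set" where
  "ac_space T = {u. \<forall>\<epsilon>>0. \<exists>\<delta>>0. \<forall>(n::nat) a b.
     (\<forall>i<n. a i \<le> b i \<and> {a i..b i} \<subseteq> {0..T}) \<and>
     disjoint_family_on (\<lambda>i. {a i<..<b i}) {..<n} \<and>
     (\<Sum>i<n. b i - a i) < \<delta> \<longrightarrow> (\<Sum>i<n. \<bar>u (b i) - u (a i)\<bar>) < \<epsilon>}"

definition ac_norm :: "real \<Rightarrow> (real \<Rightarrow> real) \<Rightarrow> real" where
  "ac_norm T u = \<bar>u 0\<bar> + (LINT t:{0..T}|lebesgue. \<bar>deriv u t\<bar>)"


section \<open>The integrated delay operator\<close>

definition delay_term :: "(real \<Rightarrow> real set \<Rightarrow> real) \<Rightarrow> (real \<Rightarrow> real) \<Rightarrow> real \<Rightarrow> real" where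
  "delay_term \<mu> x \<tau> = signed_integral delay_borel (\<mu> \<tau>) (\<lambda>s. x (\<tau> + s))"

definition delay_op :: "(real \<Rightarrow> real set \<Rightarrow> real) \<Rightarrow> (real \<Rightarrow> real) \<Rightarrow> real \<Rightarrow> real" where
  "delay_op \<mu> x t = x 0 + (LINT \<tau>:{0..t}|lebesgue. delay_term \<mu> x \<tau>)"

end

theory Submission
  imports Defs
begin

text \<open>
  The key is that \<open>\<mu> \<mapsto> delay_op \<mu> x\<close> factors through the delay term \<open>t \<mapsto> \<integral> x (t + s) d\<mu>\<^sub>t(s)\<close>, and that the
  distance of two images in the absolutely continuous norm is exactly the \<open>L\<^sup>1\<close> distance of their delay
  terms (\<open>ac_norm_delay_op_diff\<close>). The latter rests on Lebesgue's differentiation theorem: an indefinite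
  integral is differentiable almost everywhere, with the integrand as its derivative.

  Sequential continuity is then dominated convergence. For almost every \<open>t\<close> the delay terms converge
  because \<open>s \<mapsto> x (t + s)\<close> is one of the continuous test functions, and they are bounded by a multiple of
  \<open>K\<close> times the maximum of \<open>\<bar>x\<bar>\<close>. It remains to know that delay terms are measurable in \<open>t\<close>, which
  follows by discretising the time that occurs in the integrand (\<open>delay_term_measurable\<close>).
  Boundedness and measurability also give integrability of the delay terms, and a bounded density gives
  a Lipschitz, hence absolutely continuous, integral.

  Continuity in the product topology fails because a neighbourhood of the zero path constrains a path
  at finitely many times only, while the delay term is integrated over time. The path that is \<open>0\<close> at
  these times and \<open>K\<close> times a Dirac measure elsewhere lies in the neighbourhood, but for \<open>x = 1\<close> its
  delay term is \<open>K\<close> almost everywhere, so its image is at distance \<open>K * T\<close> from that of zero.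
\<close>

section \<open>Differentiating and norming indefinite integrals\<close>

text \<open>
  Lebesgue's differentiation theorem on the line. The one-sided averages over \<open>{t..t + h}\<close> converge
  almost everywhere by \<open>integrable_ccontinuous_explicit\<close>. Applied to the reflected function
  \<open>\<lambda>x. f (- x)\<close>, the same fact handles the averages over \<open>{t - h..t}\<close>, so the two one-sided
  difference quotients have the same limit off a null set.
\<close>

lemma AE_indefinite_integral_has_derivative:
  fixes f :: "real \<Rightarrow> real"
  assumes "f integrable_on {a..b}"
  shows "AE t in lebesgue. t \<in> {a<..<b} \<longrightarrow>
           ((\<lambda>x. integral {a..x} f) has_real_derivative f t) (at t)"
proof -
  define g where "g = (\<lambda>x. if x \<in> {a..b} then f x else 0)"
  have gU: "g integrable_on UNIV"
    unfolding g_def using assms by (simp only: integrable_restrict_UNIV)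
  then have g_int: "g integrable_on {c..d}" for c d
    using integrable_on_subcbox[OF gU, of c d] by simp
  have g'_int: "(\<lambda>x. g (- x)) integrable_on {c..d}" for c d
    using Henstock_Kurzweil_Integration.integrable_reflect_real[where f = g and a = "- d" and b = "- c"] g_int by simp
  obtain N1 where N1: "negligible N1"
    "\<And>x e. \<lbrakk>x \<notin> N1; 0 < e\<rbrakk> \<Longrightarrow> \<exists>d>0. \<forall>h. 0 < h \<and> h < d \<longrightarrow>
        norm (integral (cbox x (x + h *\<^sub>R One)) g /\<^sub>R h ^ DIM(real) - g x) < e"
    using integrable_ccontinuous_explicit[of g] g_int by auto
  obtain N2 where N2: "negligible N2"
    "\<And>x e. \<lbrakk>x \<notin> N2; 0 < e\<rbrakk> \<Longrightarrow> \<exists>d>0. \<forall>h. 0 < h \<and> h < d \<longrightarrow>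
        norm (integral (cbox x (x + h *\<^sub>R One)) (\<lambda>x. g (- x)) /\<^sub>R h ^ DIM(real) - g (- x)) < e"
    using integrable_ccontinuous_explicit[of "\<lambda>x. g (- x)"] g'_int by auto
  define N where "N = N1 \<union> uminus ` N2"
  have "negligible (uminus ` N2)"
    by (rule negligible_differentiable_image_negligible[OF _ N2(1)])
       (auto intro!: derivative_intros)
  then have N: "N \<in> null_sets lebesgue"
    using N1(1) by (simp add: N_def negligible_Un flip: negligible_iff_null_sets)
  have deriv: "((\<lambda>x. integral {a..x} f) has_real_derivative f t) (at t)"
    if t: "t \<in> {a<..<b}" and "t \<notin> N" for t
  proof -
    let ?F = "\<lambda>x. integral {a..x} g"
    have tN: "t \<notin> N1" "- t \<notin> N2"
      using \<open>t \<notin> N\<close> unfolding N_def by (auto simp: image_iff)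
    have "(?F has_real_derivative g t) (at t)"
      unfolding DERIV_def
    proof (rule LIM_I)
      fix e :: real assume e: "0 < e"
      obtain d1 where d1: "d1 > 0" "\<And>h. 0 < h \<Longrightarrow> h < d1 \<Longrightarrow> \<bar>integral {t..t + h} g / h - g t\<bar> < e"
        using N1(2)[OF tN(1) e] by (auto simp: divide_inverse mult.commute)
      obtain d2 where d2: "d2 > 0"
        "\<And>h. 0 < h \<Longrightarrow> h < d2 \<Longrightarrow> \<bar>integral {- t..- t + h} (\<lambda>x. g (- x)) / h - g t\<bar> < e"
        using N2(2)[OF tN(2) e] by (auto simp: divide_inverse mult.commute)
      \<comment> \<open>The bound \<open>t - a\<close> keeps \<open>t + h\<close> to the right of \<open>a\<close>, where \<open>?F\<close> is additive.\<close>
      have "\<bar>(?F (t + h) - ?F t) / h - g t\<bar> < e"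
        if "h \<noteq> 0" "\<bar>h\<bar> < min (min d1 d2) (t - a)" for h
      proof (cases "h > 0")
        case True
        have "?F t + integral {t..t + h} g = ?F (t + h)"
          using t True by (intro Henstock_Kurzweil_Integration.integral_combine g_int) auto
        then have "?F (t + h) - ?F t = integral {t..t + h} g" by linarith
        then show ?thesis using d1(2)[of h] that True by simp
      next
        case False
        with that have h: "h < 0" by simp
        have "?F (t + h) + integral {t + h..t} g = ?F t"
          using t h that by (intro Henstock_Kurzweil_Integration.integral_combine g_int) auto
        moreover have "integral {t + h..t} g = integral {- t..- t + - h} (\<lambda>x. g (- x))"
          using Henstock_Kurzweil_Integration.integral_reflect_real[of t "t + h" g] by simp
        ultimately have "?F (t + h) - ?F t = - integral {- t..- t + - h} (\<lambda>x. g (- x))"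
          by linarith
        then have "(?F (t + h) - ?F t) / h
            = integral {- t..- t + - h} (\<lambda>x. g (- x)) / (- h)"
          by simp
        then show ?thesis using d2(2)[of "- h"] that h by simp
      qed
      then show "\<exists>s>0. \<forall>h. h \<noteq> 0 \<and> norm (h - 0) < s \<longrightarrow>
          norm ((?F (t + h) - ?F t) / h - g t) < e"
        using d1(1) d2(1) t by (intro exI[of _ "min (min d1 d2) (t - a)"]) auto
    qed
    moreover have "?F x = integral {a..x} f" if "x \<in> {a<..<b}" for x
      using that by (intro integral_cong) (auto simp: g_def)
    ultimately show ?thesis
      using t has_field_derivative_transform_within_open[of ?F "g t" t "{a<..<b}"]
      by (auto simp: g_def)
  qed
  show ?thesis
    by (rule AE_I'[OF N]) (use deriv in auto)
qed

text \<open>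
  This turns the norm into an \<open>L\<^sup>1\<close> norm of the density. Almost everywhere differentiability is
  essential: at points where \<open>u\<close> is not differentiable, \<open>deriv u\<close> is an unspecified number.
\<close>

lemma ac_norm_indefinite_integral:
  assumes h: "set_integrable lebesgue {0..T} h" and "T \<ge> 0"
    and u: "\<And>t. t \<in> {0..T} \<Longrightarrow> u t = c + integral {0..t} h"
  shows "ac_norm T u = \<bar>c\<bar> + (LINT t:{0..T}|lebesgue. \<bar>h t\<bar>)"
proof -
  have hi: "h integrable_on {0..T}"
    by (rule set_lebesgue_integral_eq_integral(1)[OF h])
  have "AE t in lebesgue. t \<notin> {0, T}"
    by (intro AE_I'[of "{0, T}"]) (auto simp flip: negligible_iff_null_sets)
  with AE_indefinite_integral_has_derivative[OF hi]
  have AE: "AE t in lebesgue. indicator {0..T} t *\<^sub>R h t = indicator {0..T} t *\<^sub>R deriv u t"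
  proof eventually_elim
    case (elim t)
    show ?case
    proof (cases "t \<in> {0..T}")
      case True
      with elim(2) have t: "t \<in> {0<..<T}" by auto
      with elim(1) have "((\<lambda>x. c + integral {0..x} h) has_real_derivative h t) (at t)"
        by (auto intro!: derivative_eq_intros)
      then have "(u has_real_derivative h t) (at t)"
        by (rule has_field_derivative_transform_within_open[of _ _ _ "{0<..<T}"]) (use t u in auto)
      then show ?thesis by (simp add: DERIV_imp_deriv)
    qed simp
  qed
  have m: "(\<lambda>t. indicator {0..T} t *\<^sub>R h t) \<in> borel_measurable lebesgue"
    using h unfolding set_integrable_def by auto
  \<comment> \<open>Completeness of Lebesgue measure makes \<open>deriv u\<close> measurable, being almost everywhere equal to \<open>h\<close>.\<close>
  have m': "(\<lambda>t. indicator {0..T} t *\<^sub>R deriv u t) \<in> borel_measurable lebesgue"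
    by (rule borel_measurable_AE[OF m AE])
  have "(\<integral>t. \<bar>indicator {0..T} t *\<^sub>R deriv u t\<bar> \<partial>lebesgue) = (\<integral>t. \<bar>indicator {0..T} t *\<^sub>R h t\<bar> \<partial>lebesgue)"
    using AE m m' by (intro integral_cong_AE) auto
  then show ?thesis
    using u[of 0] \<open>T \<ge> 0\<close> by (simp add: ac_norm_def set_lebesgue_integral_def abs_mult)
qed

lemma lipschitz_imp_ac_space:
  assumes lip: "\<And>s t. 0 \<le> s \<Longrightarrow> s \<le> t \<Longrightarrow> t \<le> T \<Longrightarrow> \<bar>u t - u s\<bar> \<le> C * (t - s)" and "C \<ge> 0"
  shows "u \<in> ac_space T"
  unfolding ac_space_def
proof (intro CollectI allI impI)
  fix e :: real assume e: "e > 0"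
  show "\<exists>\<delta>>0. \<forall>(n::nat) a b.
     (\<forall>i<n. a i \<le> b i \<and> {a i..b i} \<subseteq> {0..T}) \<and>
     disjoint_family_on (\<lambda>i. {a i<..<b i}) {..<n} \<and>
     (\<Sum>i<n. b i - a i) < \<delta> \<longrightarrow> (\<Sum>i<n. \<bar>u (b i) - u (a i)\<bar>) < e"
    \<comment> \<open>\<open>C + 1\<close> rather than \<open>C\<close> in the denominator, since \<open>C\<close> may vanish.\<close>
  proof (intro exI[of _ "e / (C + 1)"] conjI allI impI; (elim conjE)?)
    show "e / (C + 1) > 0" using e \<open>C \<ge> 0\<close> by simp
  next
    fix n :: nat and a b :: "nat \<Rightarrow> real"
    assume ab: "\<forall>i<n. a i \<le> b i \<and> {a i..b i} \<subseteq> {0..T}"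
      and small: "(\<Sum>i<n. b i - a i) < e / (C + 1)"
    have pos: "0 \<le> (\<Sum>i<n. b i - a i)"
      using ab by (intro sum_nonneg) auto
    have "(\<Sum>i<n. \<bar>u (b i) - u (a i)\<bar>) \<le> (\<Sum>i<n. C * (b i - a i))"
      using ab by (intro sum_mono lip) auto
    also have "\<dots> = C * (\<Sum>i<n. b i - a i)"
      by (simp add: sum_distrib_left)
    also have "\<dots> \<le> (C + 1) * (\<Sum>i<n. b i - a i)"
      using pos by (simp add: algebra_simps)
    also have "\<dots> < e"
      using small \<open>C \<ge> 0\<close> by (simp add: field_simps)
    finally show "(\<Sum>i<n. \<bar>u (b i) - u (a i)\<bar>) < e" .
  qed
qed

section \<open>Integration against a signed measure\<close>

lemma space_positive_part [simp]: "space (positive_part M \<nu>) = space M"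
  by (simp add: positive_part_def space_measure_of_conv)

lemma sets_positive_part [simp, measurable_cong]: "sets (positive_part M \<nu>) = sets M"
  by (simp add: positive_part_def)

lemma total_variation_uminus: "total_variation M (\<lambda>A. - \<nu> A) = total_variation M \<nu>"
  by (simp add: total_variation_def)

text \<open>
  Split the space into \<open>B\<close> and its complement, dropping whichever of them is empty because the
  blocks of a partition are nonempty.
\<close>

lemma abs_le_total_variation:
  assumes B: "B \<in> sets M" and empty: "\<nu> {} = 0"
  shows "ennreal \<bar>\<nu> B\<bar> \<le> total_variation M \<nu>"
proof (cases "B = {}")
  case False
  let ?P = "{B, space M - B} - {{}}"
  have "ennreal \<bar>\<nu> B\<bar> \<le> (\<Sum>A\<in>?P. ennreal \<bar>\<nu> A\<bar>)"
    using False by (intro member_le_sum) auto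
  also have "\<dots> \<le> total_variation M \<nu>"
    unfolding total_variation_def
  proof (rule SUP_upper)
    show "?P \<in> {P. finite P \<and> P \<subseteq> sets M \<and> partition_on (space M) P}"
      using B sets.sets_into_space[OF B] by (auto simp: partition_on_def disjoint_def)
  qed
  finally show ?thesis .
qed (use empty in simp)

text \<open>
  The inequality holds for an arbitrary set function because \<open>measure_of\<close> returns the zero measure
  whenever the supremum fails to be a measure on \<open>sets M\<close>.
\<close>

lemma emeasure_positive_part_le:
  "emeasure (positive_part M \<nu>) A \<le> (SUP B \<in> {B \<in> sets M. B \<subseteq> A}. ennreal (\<nu> B))"
  by (simp add: positive_part_def emeasure_measure_of_conv)

lemma emeasure_positive_part_le_total_variation:
  assumes "\<nu> {} = 0"
  shows "emeasure (positive_part M \<nu>) A \<le> total_variation M \<nu>"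
proof -
  have "(SUP B \<in> {B \<in> sets M. B \<subseteq> A}. ennreal (\<nu> B)) \<le> total_variation M \<nu>"
  proof (rule SUP_least)
    fix B assume "B \<in> {B \<in> sets M. B \<subseteq> A}"
    then have B: "B \<in> sets M" by simp
    have "ennreal (\<nu> B) \<le> ennreal \<bar>\<nu> B\<bar>"
      by (simp add: ennreal_leI)
    also have "\<dots> \<le> total_variation M \<nu>"
      using assms B by (simp add: abs_le_total_variation)
    finally show "ennreal (\<nu> B) \<le> total_variation M \<nu>" .
  qed
  then show ?thesis
    using emeasure_positive_part_le[of M \<nu> A] by simp
qed

lemma finite_measure_positive_part:
  assumes "\<nu> {} = 0" "total_variation M \<nu> < \<infinity>"
  shows "finite_measure (positive_part M \<nu>)"
proof (rule finite_measureI)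
  have "emeasure (positive_part M \<nu>) (space M) < \<infinity>"
    by (rule le_less_trans[OF emeasure_positive_part_le_total_variation]) (use assms in auto)
  then show "emeasure (positive_part M \<nu>) (space (positive_part M \<nu>)) \<noteq> \<infinity>"
    by simp
qed

lemma integral_positive_part_nonpos:
  fixes f :: "'a \<Rightarrow> real"
  assumes "\<And>B. B \<in> sets M \<Longrightarrow> \<nu> B \<le> 0"
  shows "(\<integral>s. f s \<partial>positive_part M \<nu>) = 0"
proof -
  have "emeasure (positive_part M \<nu>) (space M) \<le> 0"
  proof (rule order_trans[OF emeasure_positive_part_le], rule SUP_least)
    fix B assume "B \<in> {B \<in> sets M. B \<subseteq> space M}"
    then show "ennreal (\<nu> B) \<le> 0" using assms[of B] by (simp add: ennreal_neg)
  qed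
  then have "space M \<in> null_sets (positive_part M \<nu>)"
    by (simp add: null_sets_def)
  then have "AE s in positive_part M \<nu>. f s = 0"
    by (rule AE_I') auto
  then show ?thesis by (rule integral_eq_zero_AE)
qed

text \<open>
  The factor 2 comes from estimating the positive and the negative part separately, each by the full
  total variation.
\<close>

lemma abs_signed_integral_le:
  assumes "\<nu> {} = 0" and TV: "total_variation M \<nu> \<le> ennreal K" and "K \<ge> 0"
    and f: "f \<in> borel_measurable M" "\<And>s. s \<in> space M \<Longrightarrow> \<bar>f s\<bar> \<le> B" and "B \<ge> 0"
  shows "\<bar>signed_integral M \<nu> f\<bar> \<le> 2 * K * B"
proof -
  have "\<bar>\<integral>s. f s \<partial>positive_part M \<rho>\<bar> \<le> K * B"
    if \<rho>: "\<rho> {} = 0" "total_variation M \<rho> \<le> ennreal K" for \<rho>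
  proof -
    interpret finite_measure "positive_part M \<rho>"
      using \<rho> by (simp add: finite_measure_positive_part le_less_trans[OF \<rho>(2)])
    have int: "integrable (positive_part M \<rho>) f"
      by (rule integrable_const_bound[of _ B]) (use f in \<open>auto intro!: AE_I2\<close>)
    have "\<bar>\<integral>s. f s \<partial>positive_part M \<rho>\<bar> \<le> (\<integral>s. \<bar>f s\<bar> \<partial>positive_part M \<rho>)"
      by (rule integral_abs_bound)
    also have "\<dots> \<le> (\<integral>s. B \<partial>positive_part M \<rho>)"
      using int f(2) by (intro integral_mono) auto
    also have "\<dots> = measure (positive_part M \<rho>) (space M) * B"
      by simp
    also have "measure (positive_part M \<rho>) (space M) \<le> K"
      using emeasure_positive_part_le_total_variation[where \<nu> = \<rho> and M = M and A = "space M"] \<rho> \<open>K \<ge> 0\<close>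
      by (metis (mono_tags) emeasure_eq_measure ennreal_le_iff order_trans)
    finally show ?thesis using \<open>B \<ge> 0\<close> by (simp add: mult_right_mono)
  qed
  from this[of \<nu>] this[of "\<lambda>A. - \<nu> A"] show ?thesis
    using assms(1) TV by (simp add: signed_integral_def total_variation_uminus)
qed

lemma signed_integral_dominated_convergence:
  assumes "\<nu> {} = 0" and TV: "total_variation M \<nu> < \<infinity>"
    and f: "\<And>n. f n \<in> borel_measurable M" "g \<in> borel_measurable M"
    and bd: "\<And>n s. s \<in> space M \<Longrightarrow> \<bar>f n s\<bar> \<le> B"
    and lim: "\<And>s. s \<in> space M \<Longrightarrow> (\<lambda>n. f n s) \<longlonglongrightarrow> g s"
  shows "(\<lambda>n. signed_integral M \<nu> (f n)) \<longlonglongrightarrow> signed_integral M \<nu> g"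
proof -
  have *: "(\<lambda>n. \<integral>s. f n s \<partial>positive_part M \<rho>) \<longlonglongrightarrow> (\<integral>s. g s \<partial>positive_part M \<rho>)"
    if \<rho>: "\<rho> {} = 0" "total_variation M \<rho> < \<infinity>" for \<rho>
  proof -
    interpret finite_measure "positive_part M \<rho>"
      using \<rho> by (simp add: finite_measure_positive_part)
    show ?thesis
      by (rule integral_dominated_convergence[where w="\<lambda>_. B"])
         (use f bd lim in \<open>auto intro!: AE_I2\<close>)
  qed
  show ?thesis
    unfolding signed_integral_def
    by (rule tendsto_diff; rule *) (use assms(1) TV in \<open>simp_all add: total_variation_uminus\<close>)
qed

section \<open>The delay operator\<close>

lemma space_delay_borel [simp]: "space delay_borel = {-1..0}"
  by (simp add: space_restrict_space)

lemma coeffsD: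
  assumes "\<nu> \<in> coeffs K"
  shows "\<nu> {} = 0" "total_variation delay_borel \<nu> \<le> ennreal K"
    "total_variation delay_borel \<nu> < \<infinity>"
  using assms by (auto simp: coeffs_def signed_measure_def intro: le_less_trans)

lemma coeff_paths_apply:
  assumes "\<mu> \<in> coeff_paths K T" "t \<in> {0..T}"
  shows "\<mu> t \<in> coeffs K"
  using assms by (auto simp: coeff_paths_def)

text \<open>
  Extending \<open>x\<close> by its boundary values makes all its translates continuous and uniformly bounded on
  the delay interval, so that a sequence of translates may be indexed by all integers.
\<close>

lemma clamp_extension:
  fixes x :: "real \<Rightarrow> real"
  assumes x: "continuous_on {a..b} x" and "a \<le> b"
  obtains y C where "continuous_on UNIV y" "\<And>t. t \<in> {a..b} \<Longrightarrow> y t = x t" "\<And>t. \<bar>y t\<bar> \<le> C" "C \<ge> 0"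
proof -
  have "bounded (x ` {a..b})"
    using x by (intro compact_imp_bounded compact_continuous_image) auto
  then have "bounded (range (\<lambda>t. x (clamp a b t)))"
    using clamp_bounded[of x a b] by simp
  then obtain C where C: "\<And>t. \<bar>x (clamp a b t)\<bar> \<le> C"
    by (auto simp: bounded_iff)
  show ?thesis
  proof (rule that[of "\<lambda>t. x (clamp a b t)" C])
    show "continuous_on UNIV (\<lambda>t. x (clamp a b t))"
      using x by (intro clamp_continuous_on) simp
    show "x (clamp a b t) = x t" if "t \<in> {a..b}" for t
      using that by simp
    show "C \<ge> 0" using C[of 0] by simp
  qed (rule C)
qed

lemma continuous_on_imp_delay_borel_measurable:
  assumes "continuous_on UNIV y"
  shows "(\<lambda>s. y (c + s)) \<in> borel_measurable delay_borel"
  by (intro borel_measurable_continuous_on_restrict continuous_intros continuous_on_compose2[OF assms]) auto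

lemma signed_integral_cong:
  assumes "\<And>s. s \<in> space M \<Longrightarrow> f s = g s"
  shows "signed_integral M \<nu> f = signed_integral M \<nu> g"
  unfolding signed_integral_def
  by (intro arg_cong2[where f = "(-)"] Bochner_Integration.integral_cong) (simp_all add: assms)

lemma delay_term_cong:
  assumes "\<And>t. t \<in> {-1..T} \<Longrightarrow> y t = x t" "t \<in> {0..T}"
  shows "delay_term \<mu> y t = delay_term \<mu> x t"
  unfolding delay_term_def using assms by (intro signed_integral_cong) auto

lemma delay_term_bounded:
  assumes "continuous_on {-1..T} x" and "K > 0" "T > 0"
  obtains C where "C \<ge> 0" "\<And>\<mu> t. \<mu> \<in> coeff_paths K T \<Longrightarrow> t \<in> {0..T} \<Longrightarrow> \<bar>delay_term \<mu> x t\<bar> \<le> C"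
proof -
  have "-1 \<le> T" using \<open>T > 0\<close> by simp
  obtain y B where y: "continuous_on UNIV y" "\<And>t. t \<in> {-1..T} \<Longrightarrow> y t = x t" "\<And>t. \<bar>y t\<bar> \<le> B" "B \<ge> 0"
    by (rule clamp_extension[OF assms(1) \<open>-1 \<le> T\<close>]) (rule that)
  have "\<bar>delay_term \<mu> x t\<bar> \<le> 2 * K * B" if \<mu>: "\<mu> \<in> coeff_paths K T" and t: "t \<in> {0..T}" for \<mu> t
  proof -
    note c = coeffsD[OF coeff_paths_apply[OF \<mu> t]]
    have "\<bar>delay_term \<mu> y t\<bar> \<le> 2 * K * B"
      unfolding delay_term_def
      by (rule abs_signed_integral_le[OF c(1,2)])
         (use y \<open>K > 0\<close> in \<open>simp_all add: continuous_on_imp_delay_borel_measurable\<close>)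
    then show ?thesis
      using delay_term_cong[of T y x t \<mu>] y(2) t by simp
  qed
  then show ?thesis
    using \<open>K > 0\<close> y(4) by (intro that[of "2 * K * B"]) auto
qed

text \<open>
  The integrand and the measure both move with \<open>t\<close>, whereas the definition of a coefficient path only
  gives measurability for a fixed integrand. So the time inside the integrand is replaced by a
  discretised time; the bounded convergence theorem for each \<open>\<mu> t\<close> shows that the delay term is the
  pointwise limit of the resulting measurable functions.
\<close>

lemma delay_term_measurable:
  assumes x: "continuous_on {-1..T} x" and \<mu>: "\<mu> \<in> coeff_paths K T" and "T > 0"
  shows "delay_term \<mu> x \<in> borel_measurable (lebesgue_on {0..T})"
proof -
  have "-1 \<le> T" using \<open>T > 0\<close> by simp
  obtain y B where y: "continuous_on UNIV y" "\<And>t. t \<in> {-1..T} \<Longrightarrow> y t = x t" "\<And>t. \<bar>y t\<bar> \<le> B" "B \<ge> 0"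
    by (rule clamp_extension[OF x \<open>-1 \<le> T\<close>]) (rule that)
  \<comment> \<open>Round the outer time down to a multiple of \<open>1 / Suc n\<close>: the translate of \<open>y\<close> then ranges over a
    countable family, and each member has a measurable integral by the definition of a coefficient
    path.\<close>
  define q where "q = (\<lambda>n t. real_of_int \<lfloor>t * real (Suc n)\<rfloor> / real (Suc n))"
  have q: "(\<lambda>n. q n t) \<longlonglongrightarrow> t" for t
  proof (rule real_tendsto_sandwich)
    show "(\<lambda>n. t + - inverse (real (Suc n))) \<longlonglongrightarrow> t"
      by (rule LIMSEQ_inverse_real_of_nat_add_minus)
    show "\<forall>\<^sub>F n in sequentially. t + - inverse (real (Suc n)) \<le> q n t"
    proof (intro always_eventually allI)
      fix n
      have "t * real (Suc n) - 1 \<le> real_of_int \<lfloor>t * real (Suc n)\<rfloor>" by linarith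
      then have "(t * real (Suc n) - 1) / real (Suc n) \<le> q n t"
        unfolding q_def by (intro divide_right_mono) auto
      then show "t + - inverse (real (Suc n)) \<le> q n t"
        by (simp add: diff_divide_distrib inverse_eq_divide del: of_nat_Suc)
    qed
    show "\<forall>\<^sub>F n in sequentially. q n t \<le> t"
      unfolding q_def by (intro always_eventually allI) (simp add: pos_divide_le_eq del: of_nat_Suc)
  qed simp
  have meas: "(\<lambda>t. signed_integral delay_borel (\<mu> t) (\<lambda>s. y (q n t + s)))
      \<in> borel_measurable (lebesgue_on {0..T})" for n
  proof -
    have 1: "(\<lambda>t. signed_integral delay_borel (\<mu> t) (\<lambda>s. y (real_of_int k / real (Suc n) + s)))
        \<in> borel_measurable (lebesgue_on {0..T})" for k :: int
    proof -
      have "continuous_on {-1..0} (\<lambda>s. y (real_of_int k / real (Suc n) + s))"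
        by (intro continuous_intros continuous_on_compose2[OF y(1)]) auto
      then show ?thesis using \<mu> by (simp add: coeff_paths_def)
    qed
    have 2: "(\<lambda>t::real. \<lfloor>t * real (Suc n)\<rfloor>) \<in> measurable (lebesgue_on {0..T}) (count_space UNIV)"
      by (rule measurable_restrict_space1, rule measurable_completion) measurable
    show ?thesis
      unfolding q_def
      by (rule measurable_compose_countable[where f = "\<lambda>k t. signed_integral delay_borel (\<mu> t)
            (\<lambda>s. y (real_of_int k / real (Suc n) + s))", OF 1 2])
  qed
  have lim: "(\<lambda>n. signed_integral delay_borel (\<mu> t) (\<lambda>s. y (q n t + s))) \<longlonglongrightarrow> delay_term \<mu> x t"
    if t: "t \<in> {0..T}" for t
  proof -
    note c = coeffsD[OF coeff_paths_apply[OF \<mu> t]]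
    have "(\<lambda>n. signed_integral delay_borel (\<mu> t) (\<lambda>s. y (q n t + s)))
        \<longlonglongrightarrow> signed_integral delay_borel (\<mu> t) (\<lambda>s. y (t + s))"
    proof (rule signed_integral_dominated_convergence[where B = B])
      fix s
      have "isCont y (t + s)"
        using y(1) by (simp add: continuous_on_eq_continuous_at)
      then show "(\<lambda>n. y (q n t + s)) \<longlonglongrightarrow> y (t + s)"
        by (rule isCont_tendsto_compose) (intro tendsto_intros q)
    qed (use c y in \<open>simp_all add: continuous_on_imp_delay_borel_measurable\<close>)
    then show ?thesis
      using delay_term_cong[of T y x t \<mu>] y(2) t by (simp add: delay_term_def)
  qed
  show ?thesis
  proof (rule borel_measurable_LIMSEQ_real)
    fix t assume "t \<in> space (lebesgue_on {0..T})"
    then show "(\<lambda>n. signed_integral delay_borel (\<mu> t) (\<lambda>s. y (q n t + s))) \<longlonglongrightarrow> delay_term \<mu> x t"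
      using lim[of t] by simp
  qed (rule meas)
qed

lemma set_integrable_bounded:
  fixes f :: "real \<Rightarrow> real"
  assumes f: "f \<in> borel_measurable (lebesgue_on {a..b})" and "\<And>t. t \<in> {a..b} \<Longrightarrow> \<bar>f t\<bar> \<le> C"
  shows "set_integrable lebesgue {a..b} f"
proof -
  have "integrable (lebesgue_on {a..b}) f"
    by (rule finite_measure.integrable_const_bound[where B = C])
       (use assms in \<open>auto intro!: AE_I2 finite_measure_lebesgue_on\<close>)
  then show ?thesis
    by (simp add: set_integrable_def integrable_restrict_space)
qed

lemma delay_term_set_integrable:
  assumes x: "continuous_on {-1..T} x" and \<mu>: "\<mu> \<in> coeff_paths K T" and "T > 0" "K > 0"
  shows "set_integrable lebesgue {0..T} (delay_term \<mu> x)"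
proof -
  obtain C where "\<And>\<mu> t. \<mu> \<in> coeff_paths K T \<Longrightarrow> t \<in> {0..T} \<Longrightarrow> \<bar>delay_term \<mu> x t\<bar> \<le> C"
    using delay_term_bounded[OF x \<open>K > 0\<close> \<open>T > 0\<close>] by blast
  with delay_term_measurable[OF x \<mu> \<open>T > 0\<close>] show ?thesis
    using \<mu> by (blast intro: set_integrable_bounded)
qed

lemma delay_op_eq:
  assumes "set_integrable lebesgue {0..T} (delay_term \<mu> x)" "t \<in> {0..T}"
  shows "delay_op \<mu> x t = x 0 + integral {0..t} (delay_term \<mu> x)"
proof -
  have "set_integrable lebesgue {0..t} (delay_term \<mu> x)"
    using assms by (auto intro: set_integrable_subset)
  then show ?thesis
    by (simp add: delay_op_def set_lebesgue_integral_eq_integral)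
qed

lemma delay_op_ac_space:
  assumes x: "continuous_on {-1..T} x" and \<mu>: "\<mu> \<in> coeff_paths K T" and "T > 0" "K > 0"
  shows "delay_op \<mu> x \<in> ac_space T"
proof -
  obtain C where C: "C \<ge> 0" "\<And>\<mu> t. \<mu> \<in> coeff_paths K T \<Longrightarrow> t \<in> {0..T} \<Longrightarrow> \<bar>delay_term \<mu> x t\<bar> \<le> C"
    using delay_term_bounded[OF x \<open>K > 0\<close> \<open>T > 0\<close>] by blast
  note int = delay_term_set_integrable[OF assms]
  note hk = set_lebesgue_integral_eq_integral(1)[OF int]
  show ?thesis
  proof (rule lipschitz_imp_ac_space[OF _ C(1)])
    fix s t assume st: "0 \<le> s" "s \<le> t" "t \<le> T"
    have st_int: "delay_term \<mu> x integrable_on {s..t}"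
      using st by (intro integrable_subinterval_real[OF hk]) auto
    have "integral {0..s} (delay_term \<mu> x) + integral {s..t} (delay_term \<mu> x) = integral {0..t} (delay_term \<mu> x)"
      using st by (intro Henstock_Kurzweil_Integration.integral_combine integrable_subinterval_real[OF hk]) auto
    then have "delay_op \<mu> x t - delay_op \<mu> x s = integral {s..t} (delay_term \<mu> x)"
      using st by (simp add: delay_op_eq[OF int])
    moreover have "norm (integral {s..t} (delay_term \<mu> x)) \<le> C * (t - s)"
      using has_integral_bound_real[OF C(1) finite.emptyI, of "delay_term \<mu> x" _ s t] C(2)[OF \<mu>]
        integrable_integral[OF st_int] st by auto
    ultimately show "\<bar>delay_op \<mu> x t - delay_op \<mu> x s\<bar> \<le> C * (t - s)"
      by simp
  qed
qed

lemma ac_norm_delay_op_diff: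
  assumes \<mu>: "set_integrable lebesgue {0..T} (delay_term \<mu> x)"
    and \<nu>: "set_integrable lebesgue {0..T} (delay_term \<nu> x)" and "T > 0"
  shows "ac_norm T (\<lambda>t. delay_op \<mu> x t - delay_op \<nu> x t) =
    (LINT t:{0..T}|lebesgue. \<bar>delay_term \<mu> x t - delay_term \<nu> x t\<bar>)"
proof -
  note hk = set_lebesgue_integral_eq_integral(1)[OF \<mu>] set_lebesgue_integral_eq_integral(1)[OF \<nu>]
  have "delay_op \<mu> x t - delay_op \<nu> x t = 0 + integral {0..t} (\<lambda>t. delay_term \<mu> x t - delay_term \<nu> x t)"
    if t: "t \<in> {0..T}" for t
  proof -
    have "delay_term \<mu> x integrable_on {0..t}" "delay_term \<nu> x integrable_on {0..t}"
      using t by (auto intro: integrable_subinterval_real[OF hk(1)] integrable_subinterval_real[OF hk(2)])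
    then show ?thesis
      using t by (simp add: delay_op_eq[OF \<mu>] delay_op_eq[OF \<nu>] Henstock_Kurzweil_Integration.integral_diff)
  qed
  then show ?thesis
    using ac_norm_indefinite_integral[OF set_integral_diff(1)[OF \<mu> \<nu>]] \<open>T > 0\<close> by simp
qed

text \<open>
  At almost every \<open>t\<close> the convergence of the coefficients can be tested against the one continuous
  function \<open>\<lambda>s. x (t + s)\<close>, which gives pointwise convergence of the delay terms. They share a bound,
  so dominated convergence makes the \<open>L\<^sup>1\<close> distance, which is the norm distance of the
  images, tend to zero. Dominated convergence is where sequences matter: it fails for nets.
\<close>

lemma delay_op_sequentially_continuous:
  assumes x: "continuous_on {-1..T} x" and "T > 0" "K > 0"
    and \<mu>s: "\<And>n. \<mu>s n \<in> coeff_paths K T" and \<mu>: "\<mu> \<in> coeff_paths K T"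
    and lim: "ae_weak_star_tendsto T \<mu>s \<mu>"
  shows "(\<lambda>n. ac_norm T (\<lambda>t. delay_op (\<mu>s n) x t - delay_op \<mu> x t)) \<longlonglongrightarrow> 0"
proof -
  obtain C where C: "\<And>\<mu> t. \<mu> \<in> coeff_paths K T \<Longrightarrow> t \<in> {0..T} \<Longrightarrow> \<bar>delay_term \<mu> x t\<bar> \<le> C"
    using delay_term_bounded[OF x \<open>K > 0\<close> \<open>T > 0\<close>] by blast
  note meas = delay_term_measurable[OF x _ \<open>T > 0\<close>]
  let ?h = "\<lambda>n t. \<bar>delay_term (\<mu>s n) x t - delay_term \<mu> x t\<bar>"
  have "AE t in lebesgue_on {0..T}. t \<in> {0..T}"
    by (rule AE_I2) simp
  with lim[unfolded ae_weak_star_tendsto_def]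
  have AE: "AE t in lebesgue_on {0..T}. (\<lambda>n. ?h n t) \<longlonglongrightarrow> 0"
  proof eventually_elim
    case (elim t)
    have "continuous_on {-1..0} (\<lambda>s. x (t + s))"
      using elim(2) by (intro continuous_on_compose2[OF x] continuous_intros) auto
    with elim(1) have "(\<lambda>n. delay_term (\<mu>s n) x t) \<longlonglongrightarrow> delay_term \<mu> x t"
      unfolding delay_term_def by blast
    then show ?case
      by (intro tendsto_rabs_zero) (simp add: LIM_zero)
  qed
  have fin: "finite_measure (lebesgue_on {0..T})"
    by (simp add: finite_measure_lebesgue_on)
  have "(\<lambda>n. \<integral>t. ?h n t \<partial>lebesgue_on {0..T}) \<longlonglongrightarrow> (\<integral>t. 0 \<partial>lebesgue_on {0..T})"
  proof (rule integral_dominated_convergence[where w = "\<lambda>_. 2 * C", OF _ _ _ AE])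
    show "integrable (lebesgue_on {0..T}) (\<lambda>_. 2 * C)"
      using fin by (simp add: finite_measure.integrable_const)
    show "AE t in lebesgue_on {0..T}. norm (?h n t) \<le> 2 * C" for n
    proof (rule AE_I2)
      fix t assume "t \<in> space (lebesgue_on {0..T})"
      then have "\<bar>delay_term (\<mu>s n) x t\<bar> \<le> C" "\<bar>delay_term \<mu> x t\<bar> \<le> C"
        using C \<mu>s \<mu> by auto
      then show "norm (?h n t) \<le> 2 * C" by simp
    qed
    show "?h n \<in> borel_measurable (lebesgue_on {0..T})" for n
      using meas[OF \<mu>s[of n]] meas[OF \<mu>] by simp
  qed simp
  moreover have "ac_norm T (\<lambda>t. delay_op (\<mu>s n) x t - delay_op \<mu> x t) = (\<integral>t. ?h n t \<partial>lebesgue_on {0..T})" for n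
    using delay_term_set_integrable[OF x \<mu>s \<open>T > 0\<close> \<open>K > 0\<close>] delay_term_set_integrable[OF x \<mu> \<open>T > 0\<close> \<open>K > 0\<close>]
    by (simp add: ac_norm_delay_op_diff \<open>T > 0\<close> set_lebesgue_integral_def integral_restrict_space)
  ultimately show ?thesis by simp
qed

section \<open>Point masses and the discontinuity\<close>

definition point_mass :: "'a measure \<Rightarrow> real \<Rightarrow> 'a \<Rightarrow> 'a set \<Rightarrow> real" where
  "point_mass M c a A = (if A \<in> sets M \<and> a \<in> A then c else 0)"

lemma point_mass_zero: "point_mass M 0 a = (\<lambda>A. 0)"
  by (auto simp: point_mass_def)

lemma signed_measure_point_mass: "signed_measure M (point_mass M c a)"
  unfolding signed_measure_def
proof (intro conjI allI impI)
  fix A :: "nat \<Rightarrow> 'a set"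
  assume A: "range A \<subseteq> sets M" and disj: "disjoint_family A"
  have U: "(\<Union>n. A n) \<in> sets M"
    using A by blast
  show "(\<lambda>n. point_mass M c a (A n)) sums point_mass M c a (\<Union>n. A n)"
  proof (cases "\<exists>k. a \<in> A k")
    case True
    then obtain k where k: "a \<in> A k" by blast
    have "a \<in> A n \<longleftrightarrow> n = k" for n
      using disj k by (auto simp: disjoint_family_on_def)
    then have "(\<lambda>n. point_mass M c a (A n)) = (\<lambda>n. if n = k then c else 0)"
      using A by (auto simp: point_mass_def fun_eq_iff)
    moreover have "point_mass M c a (\<Union>n. A n) = c"
      using U k by (auto simp: point_mass_def)
    ultimately show ?thesis
      using sums_single[of k "\<lambda>_. c"] by simp
  next
    case False
    then show ?thesis by (simp add: point_mass_def)
  qed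
qed (auto simp: point_mass_def)

lemma total_variation_point_mass: "total_variation M (point_mass M c a) \<le> ennreal \<bar>c\<bar>"
  unfolding total_variation_def
proof (rule SUP_least)
  fix P assume "P \<in> {P. finite P \<and> P \<subseteq> sets M \<and> partition_on (space M) P}"
  then have P: "finite P" "disjoint P"
    by (auto simp: partition_on_def)
  show "(\<Sum>A\<in>P. ennreal \<bar>point_mass M c a A\<bar>) \<le> ennreal \<bar>c\<bar>"
  proof (cases "\<exists>A\<in>P. a \<in> A")
    case True
    then obtain B where B: "B \<in> P" "a \<in> B" by blast
    have "point_mass M c a A = 0" if "A \<in> P - {B}" for A
      using that B P(2) by (auto simp: point_mass_def disjoint_def)
    then have "(\<Sum>A\<in>P. ennreal \<bar>point_mass M c a A\<bar>) = ennreal \<bar>point_mass M c a B\<bar>"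
      using P(1) B(1) by (simp add: sum.remove)
    also have "\<dots> \<le> ennreal \<bar>c\<bar>"
      by (simp add: point_mass_def)
    finally show ?thesis .
  next
    case False
    then have "(\<Sum>A\<in>P. ennreal \<bar>point_mass M c a A\<bar>) = 0"
      by (intro sum.neutral) (auto simp: point_mass_def)
    then show ?thesis by simp
  qed
qed

text \<open>
  The right-hand side is \<open>c\<close> times the Dirac measure at \<open>a\<close>, written as the image of a one-point space
  of mass \<open>c\<close>.
\<close>

lemma positive_part_point_mass:
  assumes "a \<in> space M" "c \<ge> 0"
  shows "positive_part M (point_mass M c a) = distr (point_measure {()} (\<lambda>_. ennreal c)) M (\<lambda>_. a)"
    (is "_ = ?N")
proof -
  have "(SUP B \<in> {B \<in> sets M. B \<subseteq> A}. ennreal (point_mass M c a B)) = emeasure ?N A"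
    if A: "A \<in> sets M" for A
  proof -
    have "emeasure ?N A = ennreal (point_mass M c a A)"
      using A assms by (subst emeasure_distr) (auto simp: emeasure_point_measure_finite_if space_point_measure point_mass_def)
    moreover have "(SUP B \<in> {B \<in> sets M. B \<subseteq> A}. ennreal (point_mass M c a B)) = ennreal (point_mass M c a A)"
    proof (rule antisym)
      show "(SUP B \<in> {B \<in> sets M. B \<subseteq> A}. ennreal (point_mass M c a B)) \<le> ennreal (point_mass M c a A)"
        using A by (intro SUP_least ennreal_leI) (use assms(2) in \<open>auto simp: point_mass_def\<close>)
      show "ennreal (point_mass M c a A) \<le> (SUP B \<in> {B \<in> sets M. B \<subseteq> A}. ennreal (point_mass M c a B))"
        using A by (intro SUP_upper) auto
    qed
    ultimately show ?thesis by simp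
  qed
  then have "positive_part M (point_mass M c a) = measure_of (space M) (sets M) (emeasure ?N)"
    unfolding positive_part_def by (intro measure_of_eq sets.space_closed) (simp add: sets.sigma_sets_eq)
  also have "\<dots> = ?N"
    using measure_of_of_measure[of ?N] by simp
  finally show ?thesis .
qed

lemma signed_integral_point_mass:
  assumes "a \<in> space M" "c \<ge> 0" "f \<in> borel_measurable M"
  shows "signed_integral M (point_mass M c a) f = c * f a"
proof -
  have "(\<integral>s. f s \<partial>positive_part M (point_mass M c a)) = (\<integral>_. f a \<partial>point_measure {()} (\<lambda>_. ennreal c))"
    using assms by (simp add: positive_part_point_mass integral_distr)
  also have "\<dots> = c * f a"
    using lebesgue_integral_point_measure_finite[of "{()}" "\<lambda>_. c" "\<lambda>_. f a"] assms(2) by (simp del: lebesgue_integral_const)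
  finally have "(\<integral>s. f s \<partial>positive_part M (point_mass M c a)) = c * f a" .
  moreover have "(\<integral>s. f s \<partial>positive_part M (\<lambda>A. - point_mass M c a A)) = 0"
    using assms(2) by (intro integral_positive_part_nonpos) (simp add: point_mass_def)
  ultimately show ?thesis
    by (simp add: signed_integral_def)
qed

lemma point_mass_in_coeffs: "0 \<le> c \<Longrightarrow> c \<le> K \<Longrightarrow> point_mass delay_borel c a \<in> coeffs K"
  unfolding coeffs_def
  by (auto intro!: signed_measure_point_mass order_trans[OF total_variation_point_mass] ennreal_leI)

text \<open>
  The constant path \<open>K\<close> times the Dirac measure at delay \<open>0\<close>, with the value \<open>0\<close> put in at the times in
  \<open>F\<close>. Taking \<open>F\<close> to be all of \<open>{0..T}\<close> gives the zero path. For finite \<open>F\<close> the modification is invisible to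
  integrals over time, but not to the product topology.
\<close>

definition punctured_path :: "real \<Rightarrow> real \<Rightarrow> real set \<Rightarrow> real \<Rightarrow> real set \<Rightarrow> real" where
  "punctured_path K T F = (\<lambda>t\<in>{0..T}. point_mass delay_borel (if t \<in> F then 0 else K) 0)"

lemma signed_integral_punctured_path:
  assumes "K > 0" "continuous_on {-1..0} f" "t \<in> {0..T}"
  shows "signed_integral delay_borel (punctured_path K T F t) f = (if t \<in> F then 0 else K * f 0)"
  using assms by (simp add: punctured_path_def signed_integral_point_mass borel_measurable_continuous_on_restrict)

lemma punctured_path_in_coeff_paths:
  assumes "K > 0" "F \<in> sets borel"
  shows "punctured_path K T F \<in> coeff_paths K T"
proof -
  have "(\<lambda>t. signed_integral delay_borel (punctured_path K T F t) f) \<in> borel_measurable (lebesgue_on {0..T})"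
    if f: "continuous_on {-1..0} f" for f
  proof -
    have "(\<lambda>t::real. if t \<in> F then 0 else K * f 0) \<in> borel_measurable borel"
      using assms(2) by measurable
    then have "(\<lambda>t::real. if t \<in> F then 0 else K * f 0) \<in> borel_measurable (lebesgue_on {0..T})"
      by (intro measurable_restrict_space1 measurable_completion) simp
    then show ?thesis
      by (rule measurable_cong[THEN iffD1, rotated]) (simp add: signed_integral_punctured_path[OF \<open>K > 0\<close> f])
  qed
  moreover have "punctured_path K T F \<in> {0..T} \<rightarrow>\<^sub>E coeffs K"
    using \<open>K > 0\<close> by (auto simp: punctured_path_def point_mass_in_coeffs)
  ultimately show ?thesis
    by (simp add: coeff_paths_def)
qed

lemma zero_path_eq_punctured_path: "zero_path T = punctured_path K T {0..T}"
  by (auto simp: zero_path_def punctured_path_def point_mass_zero restrict_def)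

lemma topspace_weak_star: "topspace weak_star = {\<nu>. signed_measure delay_borel \<nu>}"
proof -
  have "{\<nu>. signed_measure delay_borel \<nu>} \<in> {{\<nu>. signed_measure delay_borel \<nu> \<and> signed_integral delay_borel \<nu> f \<in> U} | f U.
        continuous_on {-1..0} f \<and> open U}"
    by (intro CollectI exI[of _ "\<lambda>_. 0"] exI[of _ UNIV]) simp
  then show ?thesis
    unfolding weak_star_def topology_generated_by_topspace by blast
qed

lemma topspace_subtopology_coeffs: "topspace (subtopology weak_star (coeffs K)) = coeffs K"
  unfolding topspace_subtopology topspace_weak_star by (auto simp: coeffs_def)

lemma topspace_coeff_paths_topology: "topspace (coeff_paths_topology K T) = coeff_paths K T"
  unfolding coeff_paths_topology_def topspace_subtopology[of "product_topology _ _"]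
    topspace_product_topology o_def topspace_subtopology_coeffs
  by (auto simp: coeff_paths_def)

text \<open>
  A basic open set of the product restricts only finitely many coordinates. Puncturing at exactly
  those times yields a path that agrees with the zero path wherever the open set looks.
\<close>

lemma zero_path_nbhd_contains_punctured_path:
  assumes S: "openin (coeff_paths_topology K T) S" "zero_path T \<in> S" and "K > 0"
  obtains F where "finite F" "punctured_path K T F \<in> S"
proof -
  let ?X = "\<lambda>_::real. subtopology weak_star (coeffs K)"
  obtain V where V: "openin (product_topology ?X {0..T}) V" "S = V \<inter> coeff_paths K T"
    using S(1) by (auto simp: coeff_paths_topology_def openin_subtopology)
  with S(2) obtain W where W: "zero_path T \<in> (\<Pi>\<^sub>E i\<in>{0..T}. W i)"
      "finite {i. W i \<noteq> coeffs K}" "(\<Pi>\<^sub>E i\<in>{0..T}. W i) \<subseteq> V"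
    using product_topology_open_contains_basis[OF V(1), of "zero_path T"]
    unfolding topspace_subtopology_coeffs by blast
  let ?F = "{i. W i \<noteq> coeffs K}"
  have "punctured_path K T ?F t \<in> W t" if t: "t \<in> {0..T}" for t
  proof (cases "t \<in> ?F")
    case True
    then have "punctured_path K T ?F t = zero_path T t"
      using t by (simp add: punctured_path_def zero_path_def point_mass_zero)
    then show ?thesis using W(1) t by auto
  next
    case False
    then show ?thesis
      using t \<open>K > 0\<close> by (simp add: punctured_path_def point_mass_in_coeffs)
  qed
  then have "punctured_path K T ?F \<in> V"
    using W(3) by (auto simp: punctured_path_def)
  moreover have "?F \<in> sets borel"
    using W(2) by (simp add: finite_imp_closed borel_closed)
  ultimately show ?thesis
    using that[OF W(2)] V(2) punctured_path_in_coeff_paths[OF \<open>K > 0\<close>] by blast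
qed

lemma delay_term_punctured_path:
  assumes "K > 0" "t \<in> {0..T}"
  shows "delay_term (punctured_path K T F) (\<lambda>_. 1) t = (if t \<in> F then 0 else K)"
  unfolding delay_term_def using assms by (simp add: signed_integral_punctured_path)

text \<open>
  The delay terms differ by \<open>K\<close> at all times outside \<open>F\<close>, and a finite \<open>F\<close> is a null set; hence the images of
  the punctured paths stay at a fixed distance from the image of zero.
\<close>

lemma ac_norm_delay_op_punctured_path:
  assumes "T > 0" "K > 0" "finite F"
  shows "ac_norm T (\<lambda>t. delay_op (punctured_path K T F) (\<lambda>_. 1) t - delay_op (zero_path T) (\<lambda>_. 1) t) = K * T"
proof -
  let ?d = "\<lambda>F. delay_term (punctured_path K T F) (\<lambda>_. 1)"
  have int: "set_integrable lebesgue {0..T} (?d G)" if "G \<in> sets borel" for G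
    using delay_term_set_integrable[OF _ punctured_path_in_coeff_paths[OF \<open>K > 0\<close> that] \<open>T > 0\<close> \<open>K > 0\<close>]
    by simp
  have "F \<in> sets borel"
    using \<open>finite F\<close> by (simp add: finite_imp_closed borel_closed)
  note ints = int[OF this] int[of "{0..T}", simplified]
  have "(LINT t:{0..T}|lebesgue. \<bar>?d F t - ?d {0..T} t\<bar>) = integral {0..T} (\<lambda>t. \<bar>?d F t - ?d {0..T} t\<bar>)"
    by (intro set_lebesgue_integral_eq_integral(2) set_integrable_abs set_integral_diff(1) ints)
  also have "\<dots> = integral {0..T} (\<lambda>t. K)"
    using \<open>K > 0\<close>
    by (intro integral_spike[OF negligible_finite[OF \<open>finite F\<close>]]) (simp add: delay_term_punctured_path)
  finally show ?thesis
    using ac_norm_delay_op_diff[OF ints \<open>T > 0\<close>] \<open>T > 0\<close> by (simp add: zero_path_eq_punctured_path[of T K])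
qed

lemma zero_path_in_coeff_paths: "K > 0 \<Longrightarrow> zero_path T \<in> coeff_paths K T"
  by (simp add: zero_path_eq_punctured_path[of T K] punctured_path_in_coeff_paths)

lemma delay_op_discontinuous_at_zero_path:
  assumes "T > 0" "K > 0"
  shows "\<not> ((\<lambda>\<mu>. ac_norm T (\<lambda>t. delay_op \<mu> (\<lambda>_. 1) t - delay_op (zero_path T) (\<lambda>_. 1) t))
              \<longlongrightarrow> 0) (nhdsin (coeff_paths_topology K T) (zero_path T))"
proof
  assume "((\<lambda>\<mu>. ac_norm T (\<lambda>t. delay_op \<mu> (\<lambda>_. 1) t - delay_op (zero_path T) (\<lambda>_. 1) t))
              \<longlongrightarrow> 0) (nhdsin (coeff_paths_topology K T) (zero_path T))"
  then have "\<forall>\<^sub>F \<mu> in nhdsin (coeff_paths_topology K T) (zero_path T).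
      ac_norm T (\<lambda>t. delay_op \<mu> (\<lambda>_. 1) t - delay_op (zero_path T) (\<lambda>_. 1) t) < K * T"
    by (rule order_tendstoD(2)) (rule mult_pos_pos[OF \<open>K > 0\<close> \<open>T > 0\<close>])
  then obtain S where S: "openin (coeff_paths_topology K T) S" "zero_path T \<in> S"
    and small: "\<And>\<mu>. \<mu> \<in> S \<Longrightarrow>
      ac_norm T (\<lambda>t. delay_op \<mu> (\<lambda>_. 1) t - delay_op (zero_path T) (\<lambda>_. 1) t) < K * T"
    using zero_path_in_coeff_paths[OF \<open>K > 0\<close>]
    by (auto simp: eventually_nhdsin topspace_coeff_paths_topology)
  obtain F where "finite F" "punctured_path K T F \<in> S"
    using zero_path_nbhd_contains_punctured_path[OF S \<open>K > 0\<close>] .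
  then show False
    using small ac_norm_delay_op_punctured_path[OF assms] by fastforce
qed

theorem theorem3p4:
  fixes T K :: real
  assumes "T > 0" and "K > 0"
  shows "(\<forall>x. continuous_on {-1..T} x \<longrightarrow>
            (\<forall>\<mu>\<in>coeff_paths K T.
               set_integrable lebesgue {0..T} (delay_term \<mu> x) \<and> delay_op \<mu> x \<in> ac_space T) \<and>
            (\<forall>\<mu>s. \<forall>\<mu>\<in>coeff_paths K T.
               (\<forall>n. \<mu>s n \<in> coeff_paths K T) \<and> ae_weak_star_tendsto T \<mu>s \<mu> \<longrightarrow>
               (\<lambda>n. ac_norm T (\<lambda>t. delay_op (\<mu>s n) x t - delay_op \<mu> x t)) \<longlonglongrightarrow> 0)) \<and>
         zero_path T \<in> coeff_paths K T \<and>
         \<not> ((\<lambda>\<mu>. ac_norm T (\<lambda>t. delay_op \<mu> (\<lambda>_. 1) t - delay_op (zero_path T) (\<lambda>_. 1) t))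
              \<longlongrightarrow> 0) (nhdsin (coeff_paths_topology K T) (zero_path T))"
proof (intro conjI allI impI ballI)
  fix x :: "real \<Rightarrow> real" and \<mu>
  assume x: "continuous_on {-1..T} x" and \<mu>: "\<mu> \<in> coeff_paths K T"
  show "set_integrable lebesgue {0..T} (delay_term \<mu> x)"
    by (rule delay_term_set_integrable[OF x \<mu> assms])
  show "delay_op \<mu> x \<in> ac_space T"
    by (rule delay_op_ac_space[OF x \<mu> assms])
next
  fix x :: "real \<Rightarrow> real" and \<mu>s \<mu>
  assume "continuous_on {-1..T} x" "\<mu> \<in> coeff_paths K T"
    "(\<forall>n. \<mu>s n \<in> coeff_paths K T) \<and> ae_weak_star_tendsto T \<mu>s \<mu>"
  then show "(\<lambda>n. ac_norm T (\<lambda>t. delay_op (\<mu>s n) x t - delay_op \<mu> x t)) \<longlonglongrightarrow> 0"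
    using assms by (blast intro: delay_op_sequentially_continuous)
next
  show "zero_path T \<in> coeff_paths K T"
    by (rule zero_path_in_coeff_paths[OF assms(2)])
  show "\<not> ((\<lambda>\<mu>. ac_norm T (\<lambda>t. delay_op \<mu> (\<lambda>_. 1) t - delay_op (zero_path T) (\<lambda>_. 1) t))
              \<longlongrightarrow> 0) (nhdsin (coeff_paths_topology K T) (zero_path T))"
    by (rule delay_op_discontinuous_at_zero_path[OF assms])
qed

end
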